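(* For every integer $k \ge 2$, we have $$\frac{(k!)^2}{2e^2k^4} \le f'(k) \le (1+o(1)) \cdot 4 k^6 (\ln k)^2 \cdot (k!)^2,$$ $$\frac{(k-1) \cdot (k-1)!}{ek} \le n'(k) \le (1+o(1)) \cdot 4 k^4 \ln k \cdot k!,$$ where $f'(k)$ and $n'(k)$ denote the minimum number of edges and the minimum number of vertices, respectively, in an oriented linear $k$-graph with Property O, and $o(1)$ denotes a quantity tending to $0$ as $k \to \infty$.
   Context: An oriented $k$-uniform hypergraph (oriented $k$-graph) is a pair $\mathcal{H} = (V, \mathcal{E})$, where $V$ is a finite vertex set and $\mathcal{E}$ is a family of ordered $k$-tuples of distinct vertices of $V$, such that no two $k$-tuples in $\mathcal{E}$ have the same underlying set. It is called linear if (the underlying sets of) every two distinct edges intersect in at most one vertex. A $k$-tuple $(x_1, x_2, \ldots, x_k)$ is consistent with a linear order $<$ on $V$ if $x_1 < x_2 < \cdots < x_k$. An oriented $k$-graph $\mathcal{H} = (V,\mathcal{E})$ has Property O if, for every linear order $<$ on $V$, there exists an edge $\vec{e} \in \mathcal{E}$ consistent with $<$. Define $$f'(k) := \min\{ |\mathcal{E}| : \text{there exists an oriented linear } k\text{-graph } \mathcal{H}=(V,\mathcal{E}) \text{ with Property O}\},$$ $$n'(k) := \min\{ |V| : \text{there exists an oriented linear } k\text{-graph } \mathcal{H}=(V,\mathcal{E}) \text{ with Property O}\}.$$ Here $e \approx 2.718$ is the base of the natural logarithm. The lower bounds hold for every integer $k\ge 2$; the upper bounds are asymptotic, with $o(1)\to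 0$ as $k\to\infty$. *)

theory Defs
  imports Complex_Main
begin

(* Edges are ordered tuples, encoded as lists. Injectivity of "set" on E says
   that no two edges have the same underlying set. *)
definition oriented_graph :: "nat \<Rightarrow> 'a set \<Rightarrow> 'a list set \<Rightarrow> bool" where
  "oriented_graph k V E \<longleftrightarrow>
     finite V \<and>
     (\<forall>e\<in>E. length e = k \<and> distinct e \<and> set e \<subseteq> V) \<and>
     inj_on set E"

definition linear_edges :: "'a list set \<Rightarrow> bool" where
  "linear_edges E \<longleftrightarrow> (\<forall>e\<in>E. \<forall>e'\<in>E. e \<noteq> e' \<longrightarrow> card (set e \<inter> set e') \<le> 1)"

(* The order is given by its strict part. *)
definition consistent :: "('a \<times> 'a) set \<Rightarrow> 'a list \<Rightarrow> bool" where
  "consistent r e \<longleftrightarrow> sorted_wrt (\<lambda>x y. (x, y) \<in> r) e"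

definition property_O :: "'a set \<Rightarrow> 'a list set \<Rightarrow> bool" where
  "property_O V E \<longleftrightarrow>
     (\<forall>r. r \<subseteq> V \<times> V \<and> strict_linear_order_on V r \<longrightarrow> (\<exists>e\<in>E. consistent r e))"

(* "Inf {}" is unspecified on nat. With the value 0 for the empty set, any positive lower
   bound on such a minimum entails that the set is nonempty, i.e. that the minimum exists. *)
definition min_or_0 :: "nat set \<Rightarrow> nat" where
  "min_or_0 X = (if X = {} then 0 else Inf X)"

(* Vertex sets are finite, so up to isomorphism it suffices to take vertices in nat. *)
definition min_edges :: "nat \<Rightarrow> nat" where
  "min_edges k = min_or_0 {card E | (V :: nat set) E.
     oriented_graph k V E \<and> linear_edges E \<and> property_O V E}"

definition min_vertices :: "nat \<Rightarrow> nat" where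
  "min_vertices k = min_or_0 {card V | (V :: nat set) E.
     oriented_graph k V E \<and> linear_edges E \<and> property_O V E}"

end

theory Submission
  imports Defs "HOL-Combinatorics.Permutations" "HOL-Combinatorics.Multiset_Permutations"
    "HOL-Library.FuncSet" "HOL-Number_Theory.Cong"
begin

text \<open>
  Lower bounds. In a uniformly random order an edge of size m is consistent with probability
  1/m!, independently of all edges disjoint from it. Delete from every edge a vertex of largest
  degree. If no vertex lay in D = (k-1)!/(ek) or more of the resulting (k-1)-tuples, the local
  lemma would give an order consistent with none of them, contradicting Property O. So some v
  lies in D shortened edges. By linearity they are disjoint outside v, which bounds the number of
  vertices; and their deleted vertices are distinct, each of degree at least that of v, and
  pairwise in at most one common edge, which yields at least D^2/2 edges.

  Upper bounds. For N = 1 + k! k^3, which is coprime to every positive integer below k, the graphs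
  of the N^2 affine functions i \<mapsto> a i + b from {0..<k} to the integers mod N meet pairwise in at
  most one point. There are at most n^n orders on the n = kN vertices, and each edge can be oriented
  so as to deal with a 1/k! share of the orders that are left, so N^2 > k! n ln n suffices. As this
  construction stays below the claimed bounds for every k \<ge> 2, the error terms can be taken to be 0.
\<close>

section \<open>A local lemma for finite counting measures\<close>

lemma card_Diff_avoid:
  assumes "finite \<Omega>" and "real (card (B \<inter> \<Omega>)) \<le> x * real (card \<Omega>)"
  shows "(1 - x) * real (card \<Omega>) \<le> real (card (\<Omega> - B))"
proof -
  have "card \<Omega> = card (B \<inter> \<Omega>) + card (\<Omega> - B)"
    using assms(1) by (subst card_Un_disjoint [symmetric]) (auto intro: arg_cong [where f = card])
  then show ?thesis using assms(2) by (simp add: algebra_simps)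
qed

text \<open>The induction of the local lemma, with conditional probabilities multiplied out into
  cardinalities, so that an empty set of remaining outcomes needs no special case. \<open>S\<close>
  is split into neighbours \<open>S1\<close> and non-neighbours \<open>S2\<close> of
  \<open>i\<close>: avoiding \<open>S2\<close> leaves the bound \<open>p\<close> on the share of
  \<open>A i\<close> intact, and additionally avoiding the at most \<open>d\<close> events in
  \<open>S1\<close> shrinks the remaining outcomes by a factor of at least
  \<open>(1 - x) ^ d\<close>.\<close>

lemma local_lemma_step:
  fixes A :: "'i \<Rightarrow> 'w set" and x p :: real
  assumes "finite \<Omega>" "finite I" and x: "0 \<le> x" "x \<le> 1" "p \<le> x * (1 - x) ^ d"
    and deg: "\<And>i. i \<in> I \<Longrightarrow> card (N i) \<le> d"
    and indep: "\<And>i T. i \<in> I \<Longrightarrow> T \<subseteq> I - insert i (N i) \<Longrightarrow>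
      real (card (A i \<inter> (\<Omega> - \<Union> (A ` T)))) \<le> p * real (card (\<Omega> - \<Union> (A ` T)))"
    and "S \<subseteq> I" "i \<in> I - S" and fin: "\<And>i. i \<in> I \<Longrightarrow> finite (N i)"
  shows "real (card (A i \<inter> (\<Omega> - \<Union> (A ` S)))) \<le> x * real (card (\<Omega> - \<Union> (A ` S)))"
  using \<open>S \<subseteq> I\<close> \<open>i \<in> I - S\<close>
proof (induction "card S" arbitrary: S i rule: less_induct)
  case less
  define S1 S2 where "S1 = S \<inter> N i" and "S2 = S - N i"
  have finS: "finite S" using less.prems \<open>finite I\<close> finite_subset by blast
  have S: "S = S2 \<union> S1" by (auto simp: S1_def S2_def)
  \<comment> \<open>Chain rule: the events of \<open>S1\<close> are avoided one at a time. The
    induction hypothesis applies to each new \<open>t\<close> because \<open>S2 \<union> T\<close>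
    omits \<open>t\<close> and so is strictly smaller than \<open>S\<close>.\<close>
  have lower: "(1 - x) ^ card T * real (card (\<Omega> - \<Union> (A ` S2))) \<le> real (card (\<Omega> - \<Union> (A ` (S2 \<union> T))))"
    if "finite T" "T \<subseteq> S1" for T
    using that
  proof (induction T rule: finite_induct)
    case (insert t T)
    have "S2 \<union> T \<subset> S" using insert by (auto simp: S1_def S2_def)
    then have "real (card (A t \<inter> (\<Omega> - \<Union> (A ` (S2 \<union> T))))) \<le> x * real (card (\<Omega> - \<Union> (A ` (S2 \<union> T))))"
      using insert less.prems
      by (intro less.hyps psubset_card_mono finS) (auto simp: S1_def S2_def)
    from card_Diff_avoid [OF _ this]
    have "(1 - x) * real (card (\<Omega> - \<Union> (A ` (S2 \<union> T)))) \<le> real (card (\<Omega> - \<Union> (A ` (S2 \<union> T)) - A t))"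
      using \<open>finite \<Omega>\<close> by simp
    also have "\<Omega> - \<Union> (A ` (S2 \<union> T)) - A t = \<Omega> - \<Union> (A ` (S2 \<union> insert t T))" by auto
    finally have "(1 - x) * real (card (\<Omega> - \<Union> (A ` (S2 \<union> T)))) \<le> real (card (\<Omega> - \<Union> (A ` (S2 \<union> insert t T))))" .
    moreover have "(1 - x) * ((1 - x) ^ card T * real (card (\<Omega> - \<Union> (A ` S2))))
        \<le> (1 - x) * real (card (\<Omega> - \<Union> (A ` (S2 \<union> T))))"
      using insert x by (intro mult_left_mono) auto
    ultimately show ?case using insert by (simp add: mult.assoc)
  qed simp
  have "card S1 \<le> d"
    using card_mono [OF fin, of i S1] deg [of i] less.prems by (force simp: S1_def)
  then have pow: "(1 - x) ^ d \<le> (1 - x) ^ card S1" using x by (intro power_decreasing) auto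
  have "real (card (A i \<inter> (\<Omega> - \<Union> (A ` S)))) \<le> real (card (A i \<inter> (\<Omega> - \<Union> (A ` S2))))"
    using \<open>finite \<Omega>\<close> by (intro of_nat_mono card_mono) (auto simp: S)
  also have "\<dots> \<le> p * real (card (\<Omega> - \<Union> (A ` S2)))"
    using less.prems by (intro indep) (auto simp: S2_def)
  also have "\<dots> \<le> (x * (1 - x) ^ d) * real (card (\<Omega> - \<Union> (A ` S2)))"
    using x by (intro mult_right_mono) auto
  also have "\<dots> \<le> (x * (1 - x) ^ card S1) * real (card (\<Omega> - \<Union> (A ` S2)))"
    using x pow by (intro mult_right_mono mult_left_mono) auto
  also have "\<dots> \<le> x * real (card (\<Omega> - \<Union> (A ` S)))"
  proof -
    have "finite S1" using finS by (simp add: S1_def)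
    from mult_left_mono [OF lower [OF this subset_refl] x(1)] show ?thesis
      by (simp only: mult.assoc flip: S)
  qed
  finally show ?case .
qed

text \<open>The weight \<open>1 / (d + 1)\<close> works since \<open>(1 - 1 / (d + 1)) ^ d\<close>
  is at least \<open>1 / e\<close>. For \<open>d = 0\<close> it would equal 1, which the strict
  bound \<open>x < 1\<close> excludes; there \<open>p\<close> itself serves as weight.\<close>

lemma local_lemma_weight:
  fixes p :: real
  assumes "0 \<le> p" "exp 1 * p * (real d + 1) \<le> 1"
  shows "\<exists>x. 0 \<le> x \<and> x < 1 \<and> p \<le> x * (1 - x) ^ d"
proof (cases "d = 0")
  case True
  have "exp 1 * p \<le> 1" using assms True by simp
  then have "p \<noteq> 1" "\<not> 1 < p"
    using exp_gt_one [of "1::real"] mult_strict_mono [of 1 "exp 1" 1 p] by auto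
  then show ?thesis using assms True by (intro exI [of _ p]) auto
next
  case False
  define x :: real where "x = 1 / (real d + 1)"
  have x: "0 \<le> x" "x < 1" using False by (auto simp: x_def)
  have e: "(1 + 1 / real d) ^ d \<le> exp 1"
    using False exp_ge_one_plus_x_over_n_power_n [where x = 1 and n = d] by simp
  have "1 - x = real d / (real d + 1)" "1 + 1 / real d = (real d + 1) / real d"
    using False by (simp_all add: x_def field_simps)
  then have "(1 - x) * (1 + 1 / real d) = 1" using False by simp
  then have "1 = (1 - x) ^ d * (1 + 1 / real d) ^ d" by (metis power_mult_distrib power_one)
  also have "\<dots> \<le> (1 - x) ^ d * exp 1" using x e by (intro mult_left_mono) auto
  finally have "x * 1 \<le> x * ((1 - x) ^ d * exp 1)" using x by (intro mult_left_mono) auto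
  moreover have "exp 1 * p \<le> x" using assms by (simp add: x_def pos_le_divide_eq)
  ultimately have "exp 1 * p \<le> x * ((1 - x) ^ d * exp 1)" by linarith
  also have "\<dots> = exp 1 * (x * (1 - x) ^ d)" by simp
  finally have "p \<le> x * (1 - x) ^ d" by simp
  with x show ?thesis by blast
qed

lemma local_lemma:
  fixes A :: "'i \<Rightarrow> 'w set" and p :: real
  assumes "finite \<Omega>" "\<Omega> \<noteq> {}" "finite I" and p: "0 \<le> p" "exp 1 * p * (real d + 1) \<le> 1"
    and fin: "\<And>i. i \<in> I \<Longrightarrow> finite (N i)"
    and deg: "\<And>i. i \<in> I \<Longrightarrow> card (N i) \<le> d"
    and indep: "\<And>i T. i \<in> I \<Longrightarrow> T \<subseteq> I - insert i (N i) \<Longrightarrow>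
      real (card (A i \<inter> (\<Omega> - \<Union> (A ` T)))) \<le> p * real (card (\<Omega> - \<Union> (A ` T)))"
  shows "\<exists>w\<in>\<Omega>. \<forall>i\<in>I. w \<notin> A i"
proof -
  obtain x where x: "0 \<le> x" "x < 1" "p \<le> x * (1 - x) ^ d"
    using local_lemma_weight [OF p] by blast
  \<comment> \<open>Events are avoided one after another; each removes at most the fraction
    \<open>x < 1\<close> of what is left, so the remainder never becomes empty.\<close>
  have "0 < card (\<Omega> - \<Union> (A ` S))" if "S \<subseteq> I" for S
    using finite_subset [OF that \<open>finite I\<close>] that
  proof (induction S rule: finite_induct)
    case empty
    then show ?case using assms(1,2) by (simp add: card_gt_0_iff)
  next
    case (insert i S)
    have "real (card (A i \<inter> (\<Omega> - \<Union> (A ` S)))) \<le> x * real (card (\<Omega> - \<Union> (A ` S)))"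
      using insert.prems insert.hyps
      by (intro local_lemma_step [OF \<open>finite \<Omega>\<close> \<open>finite I\<close> x(1) less_imp_le [OF x(2)] x(3) deg indep _ _ fin]) auto
    then have "(1 - x) * real (card (\<Omega> - \<Union> (A ` S))) \<le> real (card (\<Omega> - \<Union> (A ` S) - A i))"
      using \<open>finite \<Omega>\<close> by (intro card_Diff_avoid) auto
    moreover have "0 < (1 - x) * real (card (\<Omega> - \<Union> (A ` S)))"
      using insert x by (intro mult_pos_pos) auto
    ultimately have "0 < card (\<Omega> - \<Union> (A ` S) - A i)" by linarith
    moreover have "\<Omega> - \<Union> (A ` S) - A i = \<Omega> - \<Union> (A ` insert i S)" by auto
    ultimately show ?case by simp
  qed
  then have "card (\<Omega> - \<Union> (A ` I)) \<noteq> 0" by simp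
  then have "\<Omega> - \<Union> (A ` I) \<noteq> {}" by (metis card.empty)
  then show ?thesis by blast
qed

section \<open>Random orders\<close>

text \<open>A strictly increasing list is determined by its set of entries. This makes the events
  for different rearrangements of an edge disjoint.\<close>

lemma sorted_permutation_unique:
  fixes p :: "'a \<Rightarrow> nat"
  assumes "inj_on p (set e)" "\<pi> permutes set e" "\<rho> permutes set e"
    and "sorted_wrt (<) (map (p \<circ> \<pi>) e)" "sorted_wrt (<) (map (p \<circ> \<rho>) e)"
  shows "\<pi> = \<rho>"
proof -
  have "set (map (p \<circ> \<pi>) e) = set (map (p \<circ> \<rho>) e)"
    using permutes_image [OF assms(2)] permutes_image [OF assms(3)] by (simp flip: image_image image_comp)
  then have "map (p \<circ> \<pi>) e = map (p \<circ> \<rho>) e"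
    using assms by (intro strict_sorted_equal)
  then have "p (\<pi> v) = p (\<rho> v)" if "v \<in> set e" for v using that by (auto simp: map_eq_conv)
  then have "\<pi> v = \<rho> v" if "v \<in> set e" for v
    using that assms(1-3) by (meson inj_onD permutes_in_image)
  then show ?thesis using assms(2,3) by (metis permutes_not_in ext)
qed

text \<open>A permutation \<open>p\<close> of \<open>V\<close> stands for the order comparing
  vertices by their values under \<open>p\<close>. Rearranging values inside \<open>set e\<close>
  preserves \<open>M\<close> and produces \<open>fact (length e)\<close> disjoint parts of
  \<open>M\<close>, each at least as large as the part where \<open>e\<close> is increasing. The
  closure condition on \<open>M\<close> expresses that membership depends only on the values outside
  \<open>set e\<close>.\<close>

lemma permutes_sorted_indep:
  fixes V :: "nat set"
  assumes "finite V" "set e \<subseteq> V" "distinct e"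
    and M: "M \<subseteq> {p. p permutes V}"
      "\<And>p q. p \<in> M \<Longrightarrow> q permutes V \<Longrightarrow> (\<And>v. v \<notin> set e \<Longrightarrow> q v = p v) \<Longrightarrow> q \<in> M"
  shows "real (card ({p. p permutes V \<and> sorted_wrt (<) (map p e)} \<inter> M))
    \<le> 1 / fact (length e) * real (card M)"
proof -
  let ?A = "\<lambda>\<pi>. {p \<in> M. sorted_wrt (<) (map (p \<circ> \<pi>) e)}"
  let ?P = "{\<pi>. \<pi> permutes set e}"
  have finM: "finite M" using M(1) finite_permutations [OF \<open>finite V\<close>] finite_subset by blast
  have comp_M: "p \<circ> \<pi> \<in> M" if "p \<in> M" "\<pi> permutes set e" for p \<pi>
  proof (rule M(2) [OF that(1)])
    show "p \<circ> \<pi> permutes V"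
      using that M(1) assms(2) by (auto intro: permutes_compose permutes_subset)
  qed (use that(2) in \<open>simp add: permutes_not_in\<close>)
  have "card (?A id) \<le> card (?A \<pi>)" if \<pi>: "\<pi> permutes set e" for \<pi>
  proof (rule card_inj_on_le [where f = "\<lambda>p. p \<circ> inv \<pi>"])
    show "inj_on (\<lambda>p. p \<circ> inv \<pi>) (?A id)"
    proof (rule inj_onI)
      fix p q assume "p \<circ> inv \<pi> = q \<circ> inv \<pi>"
      then have "p \<circ> inv \<pi> \<circ> \<pi> = q \<circ> inv \<pi> \<circ> \<pi>" by simp
      then show "p = q" by (simp add: comp_assoc permutes_inv_o [OF \<pi>])
    qed
    show "(\<lambda>p. p \<circ> inv \<pi>) ` ?A id \<subseteq> ?A \<pi>"
    proof safe
      fix p assume "p \<in> M" "sorted_wrt (<) (map (p \<circ> id) e)"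
      then show "p \<circ> inv \<pi> \<in> M" "sorted_wrt (<) (map (p \<circ> inv \<pi> \<circ> \<pi>) e)"
        using comp_M permutes_inv [OF \<pi>] by (simp_all add: comp_assoc permutes_inv_o [OF \<pi>])
    qed
  qed (use finM in simp)
  then have "card ?P * card (?A id) \<le> (\<Sum>\<pi>\<in>?P. card (?A \<pi>))"
    using sum_bounded_below [of ?P "card (?A id)" "\<lambda>\<pi>. card (?A \<pi>)"] by simp
  also have "\<dots> = card (\<Union>\<pi>\<in>?P. ?A \<pi>)"
  proof (rule card_UN_disjoint [symmetric])
    show "\<forall>\<pi>\<in>?P. \<forall>\<rho>\<in>?P. \<pi> \<noteq> \<rho> \<longrightarrow> ?A \<pi> \<inter> ?A \<rho> = {}"
    proof (intro ballI impI)
      fix \<pi> \<rho> assume "\<pi> \<in> ?P" "\<rho> \<in> ?P" "\<pi> \<noteq> \<rho>"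
      moreover have "inj_on p (set e)" if "p \<in> M" for p
        using that M(1) permutes_inj_on [of p V] by auto
      ultimately show "?A \<pi> \<inter> ?A \<rho> = {}"
        by (auto dest: sorted_permutation_unique [of _ e \<pi> \<rho>])
    qed
  qed (use finM in \<open>auto simp: finite_permutations\<close>)
  also have "\<dots> \<le> card M" using finM by (intro card_mono) auto
  finally have "fact (length e) * card (?A id) \<le> card M"
    using \<open>distinct e\<close> by (simp add: card_permutations distinct_card)
  then have "real (fact (length e) * card (?A id)) \<le> real (card M)" by (rule of_nat_mono)
  moreover have "{p. p permutes V \<and> sorted_wrt (<) (map p e)} \<inter> M = ?A id" using M(1) by auto
  ultimately show ?thesis by (simp add: field_simps)
qed

text \<open>Each of the \<open>m\<close> entries of a tuple lies in at most \<open>D\<close> further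
  tuples, whence the \<open>Suc D\<close> in the degree bound, so every event has at most
  \<open>m * D\<close> neighbours. The events are indexed by \<open>E\<close> rather than by tuples
  because different edges may have the same shortened tuple.\<close>

lemma exists_order_avoiding:
  fixes V :: "nat set" and g :: "'i \<Rightarrow> nat list"
  assumes "finite V" "finite E"
    and g: "\<And>e. e \<in> E \<Longrightarrow> distinct (g e) \<and> length (g e) = m \<and> set (g e) \<subseteq> V"
    and deg: "\<And>v. v \<in> V \<Longrightarrow> card {e \<in> E. v \<in> set (g e)} \<le> Suc D"
    and small: "exp 1 * (real (m * D) + 1) \<le> fact m"
  shows "\<exists>p. p permutes V \<and> (\<forall>e\<in>E. \<not> sorted_wrt (<) (map p (g e)))"
proof -
  let ?\<Omega> = "{p. p permutes V}"
  let ?A = "\<lambda>e. {p. p permutes V \<and> sorted_wrt (<) (map p (g e))}"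
  let ?N = "\<lambda>e. {f \<in> E. f \<noteq> e \<and> set (g f) \<inter> set (g e) \<noteq> {}}"
  have "\<exists>p\<in>?\<Omega>. \<forall>e\<in>E. p \<notin> ?A e"
  proof (rule local_lemma [where N = ?N and d = "m * D" and p = "1 / fact m"])
    show "finite ?\<Omega>" "finite E" using assms by (auto simp: finite_permutations)
    show "0 \<le> 1 / (fact m :: real)" by simp
    show "?\<Omega> \<noteq> {}" using permutes_id by blast
    show "exp 1 * (1 / fact m) * (real (m * D) + 1) \<le> 1" using small by (simp add: field_simps)
    show "finite (?N e)" for e using assms by simp
    show "card (?N e) \<le> m * D" if "e \<in> E" for e
    proof -
      have "?N e \<subseteq> (\<Union>v\<in>set (g e). {f \<in> E. v \<in> set (g f)} - {e})" by auto
      then have "card (?N e) \<le> card (\<Union>v\<in>set (g e). {f \<in> E. v \<in> set (g f)} - {e})"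
        using assms(2) by (intro card_mono) auto
      also have "\<dots> \<le> (\<Sum>v\<in>set (g e). card ({f \<in> E. v \<in> set (g f)} - {e}))"
        by (rule card_UN_le) simp
      also have "\<dots> \<le> (\<Sum>v\<in>set (g e). D)"
      proof (rule sum_mono)
        fix v assume "v \<in> set (g e)"
        moreover from this have "v \<in> V" using g that by blast
        ultimately show "card ({f \<in> E. v \<in> set (g f)} - {e}) \<le> D"
          using deg [of v] g that by (subst card_Diff_singleton) auto
      qed
      also have "\<dots> = m * D" using g that by (simp add: distinct_card)
      finally show ?thesis .
    qed
    show "real (card (?A e \<inter> (?\<Omega> - \<Union> (?A ` T)))) \<le> 1 / fact m * real (card (?\<Omega> - \<Union> (?A ` T)))"
      if "e \<in> E" "T \<subseteq> E - insert e (?N e)" for e T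
    proof -
      have "real (card (?A e \<inter> (?\<Omega> - \<Union> (?A ` T))))
        \<le> 1 / fact (length (g e)) * real (card (?\<Omega> - \<Union> (?A ` T)))"
      proof (rule permutes_sorted_indep)
        fix p q assume p: "p \<in> ?\<Omega> - \<Union> (?A ` T)" and q: "q permutes V"
          and eq: "\<And>v. v \<notin> set (g e) \<Longrightarrow> q v = p v"
        have "map q (g f) = map p (g f)" if "f \<in> T" for f
          using that \<open>T \<subseteq> _\<close> eq by (auto simp only: map_eq_conv)
        then have "q \<notin> ?A f" if "f \<in> T" for f
          using that p by (simp del: map_eq_conv)
        then show "q \<in> ?\<Omega> - \<Union> (?A ` T)" using q by simp
      qed (use that g assms in auto)
      then show ?thesis using g that by simp
    qed
  qed
  then show ?thesis by auto
qed

section \<open>Degrees in linear graphs with Property O\<close>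

lemma strict_linear_order_on_inj:
  fixes p :: "'a \<Rightarrow> nat"
  assumes "inj_on p V"
  shows "strict_linear_order_on V {(x, y) \<in> V \<times> V. p x < p y}"
  using assms
  by (force simp: strict_linear_order_on_def trans_def irrefl_def total_on_def inj_on_def
      dest: linorder_neqE_nat)

lemma consistent_inj_iff:
  fixes p :: "'a \<Rightarrow> nat"
  assumes "set e \<subseteq> V"
  shows "consistent {(x, y) \<in> V \<times> V. p x < p y} e \<longleftrightarrow> sorted_wrt (<) (map p e)"
  unfolding consistent_def sorted_wrt_map
  using assms by (auto intro: sorted_wrt_mono_rel [rotated])

lemma property_O_inj:
  fixes p :: "'a \<Rightarrow> nat"
  assumes "property_O V E" "inj_on p V"
  shows "\<exists>e\<in>E. consistent {(x, y) \<in> V \<times> V. p x < p y} e"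
proof -
  have "{(x, y) \<in> V \<times> V. p x < p y} \<subseteq> V \<times> V" by auto
  then show ?thesis using assms strict_linear_order_on_inj unfolding property_O_def by blast
qed

lemma oriented_graph_finite_edges:
  assumes "oriented_graph k V E"
  shows "finite E"
proof (rule finite_subset)
  show "E \<subseteq> {e. set e \<subseteq> V \<and> length e = k}" using assms by (auto simp: oriented_graph_def)
  show "finite {e. set e \<subseteq> V \<and> length e = k}"
    using assms by (intro finite_lists_length_eq) (auto simp: oriented_graph_def)
qed

text \<open>An order consistent with an edge is increasing on the edge shortened by
  \<open>w e\<close>. Small degrees among the shortened edges would let the local lemma avoid them
  all, contradicting Property O. The deleted vertex stays a parameter, since the bounds on vertices
  and on edges choose it differently.\<close>

lemma property_O_high_degree:
  fixes V :: "nat set"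
  assumes H: "oriented_graph k V E" "property_O V E" and "k \<ge> 2"
    and w: "\<And>e. e \<in> E \<Longrightarrow> w e \<in> set e"
  shows "\<exists>v\<in>V. fact (k - 1) / (exp 1 * real k) \<le> real (card {e \<in> E. v \<in> set e \<and> v \<noteq> w e})"
proof (rule ccontr)
  define c where "c v = card {e \<in> E. v \<in> set e \<and> v \<noteq> w e}" for v
  define M where "M = Max (c ` V)"
  assume "\<not> ?thesis"
  then have small: "real (c v) < fact (k - 1) / (exp 1 * real k)" if "v \<in> V" for v
    using that unfolding c_def by force
  have finE: "finite E" using oriented_graph_finite_edges H by blast
  have finV: "finite V" and E: "\<And>e. e \<in> E \<Longrightarrow> length e = k \<and> distinct e \<and> set e \<subseteq> V"
    using H(1) by (auto simp: oriented_graph_def)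
  \<comment> \<open>Property O for the natural order provides an edge, hence a vertex of positive
    shortened degree. This gives \<open>M > 0\<close>, so that the truncated \<open>M - 1\<close>
    below is a true predecessor.\<close>
  obtain e0 where e0: "e0 \<in> E" using property_O_inj [OF H(2), of id] by auto
  have "card (set e0 - {w e0}) = k - 1" using E [OF e0] w [OF e0] by (simp add: distinct_card)
  then have "card (set e0 - {w e0}) \<noteq> 0" using \<open>k \<ge> 2\<close> by simp
  then have "set e0 - {w e0} \<noteq> {}" by (metis card.empty)
  then obtain v0 where v0: "v0 \<in> set e0" "v0 \<noteq> w e0" by auto
  have "v0 \<in> V" using E e0 v0 by blast
  have "0 < c v0" unfolding c_def using finE e0 v0 by (auto simp: card_gt_0_iff)
  have le_M: "c v \<le> M" if "v \<in> V" for v unfolding M_def using finV that by simp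
  then have "0 < M" using \<open>0 < c v0\<close> \<open>v0 \<in> V\<close> by force
  have "M \<in> c ` V" unfolding M_def using finV \<open>v0 \<in> V\<close> by (intro Max_in) auto
  then have M: "exp 1 * (real k * real M) < fact (k - 1)"
    using small \<open>k \<ge> 2\<close> by (auto simp: field_simps)
  \<comment> \<open>The local lemma is used with tuple length \<open>k - 1\<close> and
    \<open>M - 1\<close> further tuples per vertex; the simpler \<open>k * M\<close> dominates its
    neighbour count plus one.\<close>
  have "(k - 1) * (M - 1) + 1 \<le> k * M"
    using \<open>0 < M\<close> \<open>k \<ge> 2\<close> by (cases k; cases M) auto
  then have "exp 1 * (real ((k - 1) * (M - 1)) + 1) \<le> exp 1 * (real k * real M)"
    by (intro mult_left_mono) (simp_all flip: of_nat_mult of_nat_Suc add: add.commute)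
  with M have bound: "exp 1 * (real ((k - 1) * (M - 1)) + 1) \<le> fact (k - 1)" by linarith
  have "\<exists>p. p permutes V \<and> (\<forall>e\<in>E. \<not> sorted_wrt (<) (map p (removeAll (w e) e)))"
  proof (rule exists_order_avoiding [OF finV finE _ _ bound])
    fix e assume "e \<in> E"
    then have d: "distinct (removeAll (w e) e)" using E by (simp add: distinct_removeAll)
    have "length (removeAll (w e) e) = card (set e - {w e})"
      using distinct_card [OF d] by simp
    also have "\<dots> = k - 1" using E [OF \<open>e \<in> E\<close>] w [OF \<open>e \<in> E\<close>] by (simp add: distinct_card)
    finally show "distinct (removeAll (w e) e) \<and> length (removeAll (w e) e) = k - 1 \<and> set (removeAll (w e) e) \<subseteq> V"
      using d E [OF \<open>e \<in> E\<close>] by auto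
  next
    show "card {e \<in> E. v \<in> set (removeAll (w e) e)} \<le> Suc (M - 1)" if "v \<in> V" for v
      using le_M [OF that] \<open>0 < M\<close> by (simp add: c_def)
  qed
  then obtain p where p: "p permutes V"
    "\<And>e. e \<in> E \<Longrightarrow> \<not> sorted_wrt (<) (map p (removeAll (w e) e))" by blast
  obtain e where "e \<in> E" "consistent {(x, y) \<in> V \<times> V. p x < p y} e"
    using property_O_inj [OF H(2) permutes_inj_on [OF p(1)]] by blast
  then have "sorted_wrt (<) (map p e)" using E consistent_inj_iff [of e V p] by simp
  then have "sorted_wrt (<) (map p (removeAll (w e) e))"
    unfolding sorted_wrt_map removeAll_filter_not_eq by (rule sorted_wrt_filter)
  then show False using p(2) \<open>e \<in> E\<close> by blast
qed

section \<open>Counting vertices and edges in linear hypergraphs\<close>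

lemma linear_edges_unique:
  assumes "linear_edges E" "e \<in> E" "f \<in> E" "u \<in> set e" "u \<in> set f" "v \<in> set e" "v \<in> set f" "u \<noteq> v"
  shows "e = f"
proof (rule ccontr)
  assume "e \<noteq> f"
  then have "card (set e \<inter> set f) \<le> 1" using assms by (auto simp: linear_edges_def)
  moreover have "card {u, v} \<le> card (set e \<inter> set f)" using assms by (intro card_mono) auto
  ultimately show False using \<open>u \<noteq> v\<close> by simp
qed

text \<open>By linearity the edges through \<open>v\<close> are disjoint outside \<open>v\<close>,
  and each contributes \<open>k - 1\<close> vertices there. A subset \<open>S\<close> of the star is
  allowed because edges whose deleted vertex is \<open>v\<close> get left out.\<close>

lemma linear_star_card:
  assumes "oriented_graph k V E" "linear_edges E" "S \<subseteq> {e \<in> E. v \<in> set e}"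
  shows "card S * (k - 1) \<le> card V"
proof -
  have finS: "finite S" using assms(3) oriented_graph_finite_edges [OF assms(1)] finite_subset by fastforce
  have "card S * (k - 1) = (\<Sum>e\<in>S. card (set e - {v}))"
  proof -
    have "card (set e - {v}) = k - 1" if "e \<in> S" for e
      using that assms(1,3) by (auto simp: oriented_graph_def distinct_card subset_iff)
    then show ?thesis by simp
  qed
  also have "\<dots> = card (\<Union>e\<in>S. set e - {v})"
  proof (rule card_UN_disjoint [symmetric])
    show "\<forall>e\<in>S. \<forall>f\<in>S. e \<noteq> f \<longrightarrow> (set e - {v}) \<inter> (set f - {v}) = {}"
      using assms(3) linear_edges_unique [OF assms(2), of _ _ _ v] by blast
  qed (use finS in auto)
  also have "\<dots> \<le> card V"
    using assms(1,3) by (intro card_mono) (auto simp: oriented_graph_def)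
  finally show ?thesis .
qed

text \<open>Bonferroni: with \<open>u = card U\<close>, at least
  \<open>u * D - u * (u - 1) / 2\<close> edges meet \<open>U\<close>, as each pair of vertices
  shares at most one edge. The inequality is doubled and rearranged to stay within the natural
  numbers.\<close>

lemma linear_degree_sum:
  assumes "finite E" "linear_edges E" "finite U" "\<And>u. u \<in> U \<Longrightarrow> D \<le> card {e \<in> E. u \<in> set e}"
  shows "2 * card U * D + card U \<le> 2 * card {e \<in> E. set e \<inter> U \<noteq> {}} + (card U)\<^sup>2"
  using assms(3,4)
proof (induction U rule: finite_induct)
  case (insert u U)
  let ?C = "{e \<in> E. set e \<inter> U \<noteq> {}}" and ?Q = "{e \<in> E. u \<in> set e}"
  have "?Q \<inter> ?C = (\<Union>v\<in>U. {e \<in> E. u \<in> set e \<and> v \<in> set e})" by auto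
  then have "card (?Q \<inter> ?C) \<le> (\<Sum>v\<in>U. card {e \<in> E. u \<in> set e \<and> v \<in> set e})"
    using card_UN_le [OF insert.hyps(1)] by simp
  also have "\<dots> \<le> (\<Sum>v\<in>U. 1)"
  proof (rule sum_mono)
    fix v assume "v \<in> U"
    then have "u \<noteq> v" using insert by blast
    then show "card {e \<in> E. u \<in> set e \<and> v \<in> set e} \<le> 1"
      using linear_edges_unique [OF assms(2)] \<open>finite E\<close> by (auto simp: card_le_Suc0_iff_eq)
  qed
  finally have "card (?Q \<inter> ?C) \<le> card U" by simp
  moreover have "card ?Q + card ?C = card {e \<in> E. set e \<inter> insert u U \<noteq> {}} + card (?Q \<inter> ?C)"
    using card_Un_Int [of ?Q ?C] \<open>finite E\<close> by (simp add: Un_def conj_disj_distribL [symmetric] disj_commute cong: conj_cong)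
  moreover have "D \<le> card ?Q" using insert by blast
  moreover have "2 * card U * D + card U \<le> 2 * card ?C + (card U)\<^sup>2" using insert by blast
  ultimately show ?case using insert.hyps by (simp add: power2_eq_square algebra_simps)
qed simp

lemma property_O_linear_card_vertices:
  fixes V :: "nat set"
  assumes H: "oriented_graph k V E" "linear_edges E" "property_O V E" and "k \<ge> 2"
  shows "(real k - 1) * fact (k - 1) / (exp 1 * real k) \<le> real (card V)"
proof -
  \<comment> \<open>Only the star of one vertex is counted here, so the first entry can serve as the
    deleted vertex.\<close>
  have "hd e \<in> set e" if "e \<in> E" for e
    using that H(1) \<open>k \<ge> 2\<close> by (intro hd_in_set) (auto simp: oriented_graph_def)
  then obtain v where v: "fact (k - 1) / (exp 1 * real k) \<le> real (card {e \<in> E. v \<in> set e \<and> v \<noteq> hd e})"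
    using property_O_high_degree [OF H(1,3) \<open>k \<ge> 2\<close>] by blast
  have "card {e \<in> E. v \<in> set e \<and> v \<noteq> hd e} * (k - 1) \<le> card V"
    by (rule linear_star_card [OF H(1,2), where v = v]) auto
  then have "real (card {e \<in> E. v \<in> set e \<and> v \<noteq> hd e}) * real (k - 1) \<le> real (card V)"
    by (simp flip: of_nat_mult)
  moreover have "fact (k - 1) / (exp 1 * real k) * real (k - 1)
      \<le> real (card {e \<in> E. v \<in> set e \<and> v \<noteq> hd e}) * real (k - 1)"
    using v by (intro mult_right_mono) auto
  ultimately show ?thesis using \<open>k \<ge> 2\<close> by (simp add: of_nat_diff mult.commute)
qed

lemma property_O_linear_card_edges:
  fixes V :: "nat set"
  assumes H: "oriented_graph k V E" "linear_edges E" "property_O V E" and "k \<ge> 2"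
  shows "(fact k)\<^sup>2 / (2 * (exp 1)\<^sup>2 * real k ^ 4) \<le> real (card E)"
proof -
  let ?deg = "\<lambda>v. card {e \<in> E. v \<in> set e}"
  have finE: "finite E" using oriented_graph_finite_edges H by blast
  have "\<exists>u\<in>set e. \<forall>v\<in>set e. ?deg v \<le> ?deg u" if "e \<in> E" for e
  proof -
    have "set e \<noteq> {}" using that H(1) \<open>k \<ge> 2\<close> by (auto simp: oriented_graph_def)
    then have "Max (?deg ` set e) \<in> ?deg ` set e" by (intro Max_in) auto
    then obtain u where "u \<in> set e" "Max (?deg ` set e) = ?deg u" by blast
    moreover have "?deg v \<le> Max (?deg ` set e)" if "v \<in> set e" for v using that by simp
    ultimately show ?thesis by auto
  qed
  then have "\<forall>e\<in>E. \<exists>u. u \<in> set e \<and> (\<forall>v\<in>set e. ?deg v \<le> ?deg u)" by blast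
  then obtain w where "\<forall>e\<in>E. w e \<in> set e \<and> (\<forall>v\<in>set e. ?deg v \<le> ?deg (w e))"
    by (rule bchoice [THEN exE])
  then have w: "w e \<in> set e" "\<And>v. v \<in> set e \<Longrightarrow> ?deg v \<le> ?deg (w e)" if "e \<in> E" for e
    using that by blast+
  obtain v where v: "fact (k - 1) / (exp 1 * real k) \<le> real (card {e \<in> E. v \<in> set e \<and> v \<noteq> w e})"
    using property_O_high_degree [OF H(1,3) \<open>k \<ge> 2\<close> w(1)] by blast
  define S where "S = {e \<in> E. v \<in> set e \<and> v \<noteq> w e}"
  \<comment> \<open>Two edges of \<open>S\<close> with the same deleted vertex would share both it
    and \<open>v\<close>.\<close>
  have "inj_on w S"
  proof (rule inj_onI)
    fix e f assume "e \<in> S" "f \<in> S" "w e = w f"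
    then show "e = f" using linear_edges_unique [OF H(2), of e f v "w e"] w(1) [of e] w(1) [of f]
      by (auto simp: S_def)
  qed
  then have cardU: "card (w ` S) = card S" by (rule card_image)
  have "card S \<le> ?deg v" using finE by (intro card_mono) (auto simp: S_def)
  have "card S \<le> ?deg u" if u: "u \<in> w ` S" for u
  proof -
    obtain e where "e \<in> E" "v \<in> set e" "u = w e" using u unfolding S_def by blast
    with w(2) have "?deg v \<le> ?deg u" by blast
    with \<open>card S \<le> ?deg v\<close> show ?thesis by (rule order_trans)
  qed
  \<comment> \<open>The degree sum with \<open>card S\<close> vertices, each of degree at least
    \<open>card S\<close>; cancelling one square leaves
    \<open>(card S)\<^sup>2 \<le> 2 * card E\<close>.\<close>
  then have "2 * card S * card S + card S \<le> 2 * card {e \<in> E. set e \<inter> w ` S \<noteq> {}} + (card S)\<^sup>2"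
    using linear_degree_sum [OF finE H(2), of "w ` S" "card S"] finE cardU by (simp add: S_def)
  moreover have "card {e \<in> E. set e \<inter> w ` S \<noteq> {}} \<le> card E" using finE by (intro card_mono) auto
  ultimately have "(card S)\<^sup>2 \<le> 2 * card E" by (simp add: power2_eq_square)
  then have "(real (card S))\<^sup>2 \<le> 2 * real (card E)"
    using of_nat_mono [of "(card S)\<^sup>2" "2 * card E"] by simp
  moreover have "(fact (k - 1) / (exp 1 * real k))\<^sup>2 \<le> (real (card S))\<^sup>2"
    using v by (intro power_mono) (auto simp: S_def)
  moreover have "(fact k)\<^sup>2 / (2 * (exp 1)\<^sup>2 * real k ^ 4) = (fact (k - 1) / (exp 1 * real k))\<^sup>2 / 2"
    using \<open>k \<ge> 2\<close> by (simp add: fact_reduce [of k] field_simps power2_eq_square power4_eq_xxxx)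
  ultimately show ?thesis by linarith
qed

section \<open>Orienting a hypergraph with many edges\<close>

text \<open>The number of predecessors strictly increases along \<open>r\<close>. Replacing the
  relation by this rank makes orders countable and lets vertex sets be sorted.\<close>

lemma strict_linear_order_rank:
  assumes "finite V" "r \<subseteq> V \<times> V" "strict_linear_order_on V r" "x \<in> V" "y \<in> V"
  shows "(x, y) \<in> r \<longleftrightarrow> card {u. (u, x) \<in> r} < card {u. (u, y) \<in> r}"
proof -
  have mono: "card {u. (u, a) \<in> r} < card {u. (u, b) \<in> r}" if "(a, b) \<in> r" for a b
  proof (rule psubset_card_mono)
    show "finite {u. (u, b) \<in> r}" using assms(1,2) by (auto intro: finite_subset [of _ V])
    have "(a, a) \<notin> r" using assms(3) by (auto simp: strict_linear_order_on_def irrefl_def)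
    moreover have "{u. (u, a) \<in> r} \<subseteq> {u. (u, b) \<in> r}"
      using assms(3) that by (auto simp: strict_linear_order_on_def dest: transD)
    ultimately show "{u. (u, a) \<in> r} \<subset> {u. (u, b) \<in> r}" using that by auto
  qed
  have "x = y \<or> (x, y) \<in> r \<or> (y, x) \<in> r"
    using assms(3-5) by (auto simp: strict_linear_order_on_def total_on_def)
  then show ?thesis using mono [of x y] mono [of y x] by auto
qed

lemma finite_strict_linear_orders:
  "finite V \<Longrightarrow> finite {r. r \<subseteq> V \<times> V \<and> strict_linear_order_on V r}"
  by (rule finite_subset [of _ "Pow (V \<times> V)"]) auto

text \<open>An order is determined by its rank function, whose values stay below
  \<open>card V\<close> because no vertex precedes itself. The crude count of all such functions
  suffices for the construction.\<close>

lemma card_strict_linear_orders: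
  assumes "finite V"
  shows "card {r. r \<subseteq> V \<times> V \<and> strict_linear_order_on V r} \<le> card V ^ card V"
proof -
  let ?R = "{r. r \<subseteq> V \<times> V \<and> strict_linear_order_on V r}"
  let ?rank = "\<lambda>r. restrict (\<lambda>v. card {u. (u, v) \<in> r}) V"
  have "card ?R \<le> card (V \<rightarrow>\<^sub>E {..<card V})"
  proof (rule card_inj_on_le)
    show "inj_on ?rank ?R"
    proof (rule inj_onI)
      fix r s assume rs: "r \<in> ?R" "s \<in> ?R" and eq: "?rank r = ?rank s"
      have rank: "card {u. (u, x) \<in> r} = card {u. (u, x) \<in> s}" if "x \<in> V" for x
        using fun_cong [OF eq, of x] that by simp
      have "(x, y) \<in> r \<longleftrightarrow> (x, y) \<in> s" if "x \<in> V" "y \<in> V" for x y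
        using strict_linear_order_rank [OF assms, of r x y] strict_linear_order_rank [OF assms, of s x y]
          rs that rank by simp
      then show "r = s" using rs by auto
    qed
    show "?rank ` ?R \<subseteq> V \<rightarrow>\<^sub>E {..<card V}"
    proof (rule image_subsetI)
      fix r assume r: "r \<in> ?R"
      have "card {u. (u, v) \<in> r} < card V" if "v \<in> V" for v
      proof (rule psubset_card_mono [OF assms])
        have "(v, v) \<notin> r" using r by (auto simp: strict_linear_order_on_def irrefl_def)
        then show "{u. (u, v) \<in> r} \<subset> V" using r that by auto
      qed
      then show "?rank r \<in> V \<rightarrow>\<^sub>E {..<card V}" by auto
    qed
    show "finite (V \<rightarrow>\<^sub>E {..<card V})" using assms by (intro finite_PiE) auto
  qed
  also have "\<dots> = card V ^ card V" using assms by (simp add: card_funcsetE)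
  finally show ?thesis .
qed

lemma consistent_list_exists:
  assumes "finite V" "r \<subseteq> V \<times> V" "strict_linear_order_on V r" "S \<subseteq> V"
  shows "\<exists>e\<in>permutations_of_set S. consistent r e"
proof -
  let ?f = "\<lambda>v. card {u. (u, v) \<in> r}"
  obtain xs where xs: "set xs = S" "distinct xs"
    using finite_distinct_list finite_subset [OF assms(4,1)] by blast
  let ?e = "sort_key ?f xs"
  have inj: "inj_on ?f S"
  proof (rule inj_onI)
    fix x y assume "x \<in> S" "y \<in> S" "?f x = ?f y"
    moreover have "x = y \<or> (x, y) \<in> r \<or> (y, x) \<in> r"
      using assms(3,4) \<open>x \<in> S\<close> \<open>y \<in> S\<close> by (auto simp: strict_linear_order_on_def total_on_def)
    ultimately show "x = y"
      using strict_linear_order_rank [OF assms(1-3), of x y] strict_linear_order_rank [OF assms(1-3), of y x] assms(4)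
      by auto
  qed
  then have "sorted_wrt (<) (map ?f ?e)"
    using xs by (simp add: strict_sorted_iff distinct_map)
  then have "sorted_wrt (\<lambda>x y. ?f x < ?f y) ?e" by (simp add: sorted_wrt_map)
  moreover have "(x, y) \<in> r" if "x \<in> set ?e" "y \<in> set ?e" "?f x < ?f y" for x y
    using that strict_linear_order_rank [OF assms(1-3), of x y] assms(4) xs(1) by auto
  ultimately have "consistent r ?e"
    unfolding consistent_def by (rule sorted_wrt_mono_rel [rotated])
  then show ?thesis using xs by (intro bexI [of _ ?e]) (auto simp: permutations_of_set_def)
qed

text \<open>Pigeonhole: every order in \<open>R\<close> is consistent with one of the
  \<open>fact (card S)\<close> arrangements of \<open>S\<close>.\<close>

lemma exists_popular_list:
  assumes "finite S" "finite R" "\<And>r. r \<in> R \<Longrightarrow> \<exists>e\<in>permutations_of_set S. consistent r e"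
  shows "\<exists>e\<in>permutations_of_set S. card R \<le> fact (card S) * card {r \<in> R. consistent r e}"
proof (rule ccontr)
  let ?P = "permutations_of_set S" and ?c = "\<lambda>e. card {r \<in> R. consistent r e}"
  have cardP: "card ?P = fact (card S)" using assms(1) by simp
  assume "\<not> ?thesis"
  then have less: "fact (card S) * ?c e < card R" if "e \<in> ?P" for e using that by force
  have "?P \<noteq> {}" using assms(1) by (simp add: permutations_of_set_empty_iff)
  have "R = (\<Union>e\<in>?P. {r \<in> R. consistent r e})" using assms(3) by auto
  then have "card R \<le> (\<Sum>e\<in>?P. ?c e)" using card_UN_le [of ?P "\<lambda>e. {r \<in> R. consistent r e}"] by simp
  then have "fact (card S) * card R \<le> (\<Sum>e\<in>?P. fact (card S) * ?c e)"
    by (simp flip: sum_distrib_left)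
  also have "\<dots> < (\<Sum>e\<in>?P. card R)"
    using less \<open>?P \<noteq> {}\<close> by (intro sum_strict_mono) auto
  also have "\<dots> = fact (card S) * card R" using cardP by simp
  finally show False by simp
qed

text \<open>The method of conditional expectations: every edge in turn is given an ordering that is
  consistent with at least an average share of the linear orders still to be dealt with.\<close>

lemma greedy_orientation:
  assumes "finite F" "finite R" "\<And>S. S \<in> F \<Longrightarrow> finite S \<and> card S = k"
    and "\<And>r S. r \<in> R \<Longrightarrow> S \<in> F \<Longrightarrow> \<exists>e\<in>permutations_of_set S. consistent r e"
  shows "\<exists>h. (\<forall>S\<in>F. h S \<in> permutations_of_set S) \<and>
    card {r \<in> R. \<forall>S\<in>F. \<not> consistent r (h S)} * fact k ^ card F \<le> card R * (fact k - 1) ^ card F"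
  using assms(1,3,4)
proof (induction F rule: finite_induct)
  case (insert S F)
  have "\<exists>h. (\<forall>T\<in>F. h T \<in> permutations_of_set T) \<and>
    card {r \<in> R. \<forall>T\<in>F. \<not> consistent r (h T)} * fact k ^ card F \<le> card R * (fact k - 1) ^ card F"
    using insert.prems by (intro insert.IH) auto
  then obtain h where h: "\<forall>T\<in>F. h T \<in> permutations_of_set T"
    and le: "card {r \<in> R. \<forall>T\<in>F. \<not> consistent r (h T)} * fact k ^ card F \<le> card R * (fact k - 1) ^ card F"
    by blast
  let ?Q = "{r \<in> R. \<forall>T\<in>F. \<not> consistent r (h T)}"
  obtain e where e: "e \<in> permutations_of_set S" "card ?Q \<le> fact k * card {r \<in> ?Q. consistent r e}"
    using exists_popular_list [of S ?Q] insert.prems \<open>finite R\<close> by auto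
  let ?h = "h(S := e)"
  have Q': "{r \<in> R. \<forall>T\<in>insert S F. \<not> consistent r (?h T)} = ?Q - {r \<in> ?Q. consistent r e}"
    using insert.hyps by auto
  have "card (?Q - {r \<in> ?Q. consistent r e}) = card ?Q - card {r \<in> ?Q. consistent r e}"
    using \<open>finite R\<close> by (intro card_Diff_subset) auto
  \<comment> \<open>Removing \<open>c\<close> orders from \<open>q\<close>, where
    \<open>q \<le> fact k * c\<close>, leaves at most the share
    \<open>1 - 1 / fact k\<close>.\<close>
  then have "card (?Q - {r \<in> ?Q. consistent r e}) * fact k \<le> card ?Q * (fact k - 1)"
    using e(2) by (simp add: diff_mult_distrib diff_mult_distrib2 mult.commute)
  then have "card (?Q - {r \<in> ?Q. consistent r e}) * fact k * fact k ^ card F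
      \<le> card ?Q * (fact k - 1) * fact k ^ card F"
    by (rule mult_le_mono1)
  also have "\<dots> = card ?Q * fact k ^ card F * (fact k - 1)" by (simp only: ac_simps)
  also have "\<dots> \<le> card R * (fact k - 1) ^ card F * (fact k - 1)"
    using le by (rule mult_le_mono1)
  finally have "card {r \<in> R. \<forall>T\<in>insert S F. \<not> consistent r (?h T)} * fact k ^ card (insert S F)
      \<le> card R * (fact k - 1) ^ card (insert S F)"
    unfolding Q' using insert.hyps by (simp add: ac_simps)
  moreover have "\<forall>T\<in>insert S F. ?h T \<in> permutations_of_set T" using h e by auto
  ultimately show ?case by blast
qed simp

text \<open>The hypothesis \<open>small\<close> says that the number of orders times
  \<open>(1 - 1 / fact k) ^ card F\<close> is below one. The greedy choice then leaves fewer than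
  one order unserved, hence none.\<close>

lemma exists_property_O_orientation:
  fixes F :: "'a set set"
  assumes "finite V" "\<And>S. S \<in> F \<Longrightarrow> S \<subseteq> V \<and> card S = k"
    and lin: "\<And>S T. S \<in> F \<Longrightarrow> T \<in> F \<Longrightarrow> S \<noteq> T \<Longrightarrow> card (S \<inter> T) \<le> 1"
    and small: "card V ^ card V * (fact k - 1) ^ card F < (fact k ^ card F :: nat)"
  shows "\<exists>E. oriented_graph k V E \<and> linear_edges E \<and> property_O V E \<and> card E = card F"
proof -
  let ?R = "{r. r \<subseteq> V \<times> V \<and> strict_linear_order_on V r}"
  have "F \<subseteq> Pow V" using assms(2) by blast
  then have finF: "finite F" using \<open>finite V\<close> by (meson finite_Pow_iff finite_subset)
  have finS: "finite S" if "S \<in> F" for S using assms(1,2) that finite_subset by blast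
  have "\<exists>h. (\<forall>S\<in>F. h S \<in> permutations_of_set S) \<and>
    card {r \<in> ?R. \<forall>S\<in>F. \<not> consistent r (h S)} * fact k ^ card F \<le> card ?R * (fact k - 1) ^ card F"
    using consistent_list_exists [OF assms(1)] assms(2) finS
    by (intro greedy_orientation [OF finF finite_strict_linear_orders [OF assms(1)]]) auto
  then obtain h where h: "\<And>S. S \<in> F \<Longrightarrow> h S \<in> permutations_of_set S"
    and le: "card {r \<in> ?R. \<forall>S\<in>F. \<not> consistent r (h S)} * fact k ^ card F \<le> card ?R * (fact k - 1) ^ card F"
    by blast
  let ?B = "{r \<in> ?R. \<forall>S\<in>F. \<not> consistent r (h S)}"
  have "card ?R * (fact k - 1) ^ card F \<le> card V ^ card V * (fact k - 1) ^ card F"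
    by (rule mult_le_mono1 [OF card_strict_linear_orders [OF assms(1)]])
  with le small have "card ?B * fact k ^ card F < 1 * (fact k ^ card F :: nat)" by linarith
  then have "card ?B = 0" by (simp only: mult_less_cancel2) simp
  moreover have "finite ?B"
    by (rule finite_subset [OF _ finite_strict_linear_orders [OF assms(1)]]) blast
  ultimately have "?B = {}" by (simp only: card_0_eq)
  have set_h: "set (h S) = S" "distinct (h S)" "length (h S) = k" if "S \<in> F" for S
  proof -
    show eq: "set (h S) = S" and dist: "distinct (h S)"
      using h [OF that] by (auto simp: permutations_of_set_def)
    show "length (h S) = k" using distinct_card [OF dist] assms(2) [OF that] by (simp add: eq)
  qed
  have "inj_on h F" using set_h by (metis inj_onI)
  have "oriented_graph k V (h ` F)"
    unfolding oriented_graph_def using assms(1,2) set_h by (auto simp: inj_on_def)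
  moreover have "linear_edges (h ` F)" unfolding linear_edges_def using lin set_h by auto
  moreover have "property_O V (h ` F)" unfolding property_O_def using \<open>?B = {}\<close> by blast
  moreover have "card (h ` F) = card F" using \<open>inj_on h F\<close> by (rule card_image)
  ultimately show ?thesis by blast
qed

section \<open>A linear hypergraph of affine lines\<close>

text \<open>The graph of the affine function with slope \<open>a\<close> and intercept
  \<open>b\<close> modulo \<open>N\<close>. The point \<open>(i, y)\<close> is coded as
  \<open>i * N + y\<close>, so vertices are naturals and \<open>div N\<close> recovers
  \<open>i\<close>.\<close>

definition line :: "nat \<Rightarrow> nat \<Rightarrow> nat \<times> nat \<Rightarrow> nat set" where
  "line k N = (\<lambda>(a, b). (\<lambda>i. i * N + (a * i + b) mod N) ` {..<k})"

lemma line_subset: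
  assumes "0 < N"
  shows "line k N ab \<subseteq> {..<k * N}"
proof -
  have "i * N + x mod N < k * N" if "i < k" for i x
  proof -
    have "i * N + x mod N < Suc i * N" using assms by simp
    also have "\<dots> \<le> k * N" using that by (intro mult_le_mono1) simp
    finally show ?thesis .
  qed
  then show ?thesis by (auto simp: line_def)
qed

lemma card_line:
  assumes "0 < N"
  shows "card (line k N ab) = k"
proof -
  have "inj_on (\<lambda>i. i * N + f i mod N) {..<k}" for f
    by (rule inj_on_inverseI [where g = "\<lambda>v. v div N"]) (use assms in simp)
  then show ?thesis by (cases ab) (simp add: line_def card_image)
qed

text \<open>Two common points with first coordinates \<open>i\<close> and \<open>j\<close> give that
  \<open>N\<close> divides \<open>(a - c) * (i - j)\<close>. Coprimality of \<open>N\<close> to the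
  nonzero difference, which is below \<open>k\<close> in absolute value, does the work of primality,
  and parameters congruent modulo \<open>N\<close> and below \<open>N\<close> are equal.\<close>

lemma line_unique:
  assumes "u \<in> line k N (a, b)" "v \<in> line k N (a, b)" "u \<in> line k N (c, d)" "v \<in> line k N (c, d)" "u \<noteq> v"
    and "a < N" "b < N" "c < N" "d < N" and cop: "\<And>j. 0 < j \<Longrightarrow> j < k \<Longrightarrow> coprime j N"
  shows "a = c \<and> b = d"
proof -
  obtain i where i: "i < k" "u = i * N + (a * i + b) mod N" using assms(1) by (auto simp: line_def)
  obtain i' where i': "u = i' * N + (c * i' + d) mod N" using assms(3) by (auto simp: line_def)
  obtain j where j: "j < k" "v = j * N + (a * j + b) mod N" using assms(2) by (auto simp: line_def)
  obtain j' where j': "v = j' * N + (c * j' + d) mod N" using assms(4) by (auto simp: line_def)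
  have "0 < N" using assms by simp
  have "u div N = i" "u div N = i'" unfolding i(2) by (simp add: \<open>0 < N\<close>) (simp add: i' \<open>0 < N\<close> flip: i(2))
  then have ci: "[a * i + b = c * i + d] (mod N)" using i i' by (simp add: cong_def)
  have "v div N = j" "v div N = j'" unfolding j(2) by (simp add: \<open>0 < N\<close>) (simp add: j' \<open>0 < N\<close> flip: j(2))
  then have cj: "[a * j + b = c * j + d] (mod N)" using j j' by (simp add: cong_def)
  have "i \<noteq> j" using i j \<open>u \<noteq> v\<close> by auto
  have di: "int N dvd (int a * i + b) - (int c * i + d)"
    using ci by (simp flip: cong_iff_dvd_diff cong_int_iff)
  have dj: "int N dvd (int a * j + b) - (int c * j + d)"
    using cj by (simp flip: cong_iff_dvd_diff cong_int_iff)
  have "int N dvd (int a - int c) * (int i - int j)"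
    using dvd_diff [OF di dj] by (simp add: algebra_simps)
  moreover have "coprime (int N) (int i - int j)"
  proof -
    have "coprime (nat \<bar>int i - int j\<bar>) N" using \<open>i \<noteq> j\<close> i j by (intro cop) auto
    then have "coprime (int (nat \<bar>int i - int j\<bar>)) (int N)" by (simp only: coprime_int_iff)
    then show ?thesis by (simp add: coprime_commute)
  qed
  ultimately have "int N dvd int a - int c" by (simp add: coprime_dvd_mult_left_iff)
  then have "a = c"
    using assms(6,8) zdvd_imp_le [of "int N" "int a - int c"] zdvd_imp_le [of "int N" "int c - int a"]
    by (fastforce simp: dvd_diff_commute)
  then have "int N dvd int b - int d" using di by simp
  then have "b = d"
    using assms(7,9) zdvd_imp_le [of "int N" "int b - int d"] zdvd_imp_le [of "int N" "int d - int b"]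
    by (fastforce simp: dvd_diff_commute)
  with \<open>a = c\<close> show ?thesis by simp
qed

lemma card_lines_inter:
  assumes "a < N" "b < N" "c < N" "d < N" "(a, b) \<noteq> (c, d)"
    and cop: "\<And>j. 0 < j \<Longrightarrow> j < k \<Longrightarrow> coprime j N"
  shows "card (line k N (a, b) \<inter> line k N (c, d)) \<le> 1"
proof -
  have "finite (line k N (a, b) \<inter> line k N (c, d))" by (simp add: line_def)
  moreover have "u = v" if "u \<in> line k N (a, b) \<inter> line k N (c, d)" "v \<in> line k N (a, b) \<inter> line k N (c, d)" for u v
  proof (rule ccontr)
    assume "u \<noteq> v"
    have "a = c \<and> b = d"
      by (rule line_unique [of u k N a b v c d]) (use that assms \<open>u \<noteq> v\<close> in auto)
    with assms(5) show False by simp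
  qed
  ultimately show ?thesis by (simp add: card_le_Suc0_iff_eq)
qed

section \<open>Numerical estimates and existence of a linear graph with Property O\<close>

lemma exp_1_ge: "5 / 2 \<le> exp (1 :: real)"
  using exp_lower_Taylor_quadratic [of 1] by simp

text \<open>The left side is the number of vertices of the construction, so its logarithm is at most
  \<open>k\<^sup>2\<close>. In the induction the left side grows by a factor of at most
  \<open>81 / 16 * (k + 1)\<close>, the right side by \<open>exp (2 * k + 1)\<close>.\<close>

lemma fact_power_le_exp_square:
  assumes "k \<ge> 2"
  shows "real k + fact k * real k ^ 4 \<le> exp ((real k)\<^sup>2)"
  using assms
proof (induction k rule: nat_induct_at_least)
  case base
  \<comment> \<open>For \<open>k = 2\<close> the left side is 34, below \<open>(5 / 2) ^ 4\<close>,
    which exceeds 39.\<close>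
  have "(5 / 2) ^ 4 \<le> exp (1 :: real) ^ 4" using exp_1_ge by (intro power_mono) auto
  also have "\<dots> = exp 4" by (simp flip: exp_of_nat_mult)
  finally show ?case by (simp add: fact_numeral power_divide)
next
  case (Suc k)
  define x where "x = real k"
  have x: "2 \<le> x" using Suc by (simp add: x_def)
  \<comment> \<open>Since \<open>x \<ge> 2\<close>, \<open>x + 1\<close> is at most
    \<open>3 / 2 * x\<close>; the fourth power yields \<open>81 / 16\<close>.\<close>
  have "(x + 1) ^ 4 \<le> (3 / 2 * x) ^ 4" using x by (intro power_mono) auto
  then have p: "(x + 1) ^ 4 \<le> 81 / 16 * x ^ 4" by (simp add: power_mult_distrib power_divide)
  have factor: "(x + 1) * (c * x + f * (c * y)) = (c * (x + 1)) * (x + f * y)" for c f y :: real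
    by (simp add: algebra_simps)
  have "real (Suc k) + fact (Suc k) * real (Suc k) ^ 4 = (x + 1) * (1 + fact k * (x + 1) ^ 4)"
    by (simp add: x_def algebra_simps)
  also have "\<dots> \<le> (x + 1) * (81 / 16 * x + fact k * (81 / 16 * x ^ 4))"
    using x p by (intro mult_left_mono add_mono) auto
  also have "\<dots> = (81 / 16 * (x + 1)) * (x + fact k * x ^ 4)" by (rule factor)
  also have "\<dots> \<le> exp (2 * x + 1) * exp (x\<^sup>2)"
  proof (rule mult_mono)
    have "2 * x \<le> x * x" using x by (intro mult_right_mono) auto
    then have "81 / 16 * (x + 1) \<le> 5 / 2 + 4 * x + 2 * (x * x)" using x by argo
    also have "\<dots> = 1 + (2 * x + 1) + (2 * x + 1)\<^sup>2 / 2"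
      by (simp add: power2_eq_square field_simps)
    also have "\<dots> \<le> exp (2 * x + 1)" using x by (intro exp_lower_Taylor_quadratic) auto
    finally show "81 / 16 * (x + 1) \<le> exp (2 * x + 1)" .
  qed (use Suc.IH x in \<open>auto simp: x_def\<close>)
  also have "\<dots> = exp ((real (Suc k))\<^sup>2)"
    by (simp add: x_def power2_eq_square algebra_simps flip: exp_add)
  finally show ?case .
qed

text \<open>Here \<open>c\<close> bounds \<open>ln n\<close>, so \<open>n ^ n\<close> is at most
  \<open>exp (c * n)\<close>, while \<open>(1 - 1 / f) ^ m\<close> is at most
  \<open>exp (- m / f)\<close>.\<close>

lemma counting_bound:
  fixes f m n :: nat and c :: real
  assumes "0 < f" "real n \<le> exp c" "c * real n * real f < real m"
  shows "n ^ n * (f - 1) ^ m < f ^ m"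
proof -
  have "real n ^ n \<le> exp c ^ n" using assms(2) by (intro power_mono) auto
  also have "\<dots> = exp (c * real n)" by (simp add: mult.commute flip: exp_of_nat_mult)
  also have "\<dots> < exp (real m / real f)" using assms(1,3) by (simp add: field_simps)
  finally have n: "real n ^ n < exp (real m / real f)" .
  have "1 - 1 / real f \<le> exp (- (1 / real f))" using exp_ge_add_one_self [of "- (1 / real f)"] by simp
  then have "real (f - 1) \<le> real f * exp (- (1 / real f))"
    using assms(1) by (simp add: of_nat_diff field_simps)
  then have "real (f - 1) ^ m \<le> (real f * exp (- (1 / real f))) ^ m" by (intro power_mono) auto
  also have "\<dots> = real f ^ m * exp (- (real m / real f))"
    by (simp add: power_mult_distrib flip: exp_of_nat_mult)
  finally have "real n ^ n * real (f - 1) ^ m \<le> real n ^ n * (real f ^ m * exp (- (real m / real f)))"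
    by (intro mult_left_mono) auto
  also have "\<dots> < exp (real m / real f) * (real f ^ m * exp (- (real m / real f)))"
    using n assms(1) by (intro mult_strict_right_mono) auto
  also have "\<dots> = real f ^ m" by (simp add: exp_minus field_simps)
  finally have "real (n ^ n * (f - 1) ^ m) < real (f ^ m)" by simp
  then show ?thesis by (simp only: of_nat_less_iff)
qed

lemma exists_linear_property_O:
  assumes "k \<ge> 2"
  shows "\<exists>(V :: nat set) E. oriented_graph k V E \<and> linear_edges E \<and> property_O V E \<and>
    card V = k + fact k * k ^ 4 \<and> card E = (1 + fact k * k ^ 3)\<^sup>2"
proof -
  define N :: nat where "N = 1 + fact k * k ^ 3"
  let ?I = "{..<N} \<times> {..<N}"
  have "0 < N" by (simp add: N_def)
  have cop: "coprime j N" if "0 < j" "j < k" for j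
  proof -
    have "j dvd fact k * k ^ 3" using that by (intro dvd_mult2 dvd_fact) auto
    then show ?thesis unfolding N_def by (metis add.commute coprime_1_right coprime_iff_gcd_eq_1 dvd_def gcd_add_mult mult.commute)
  qed
  have inter: "card (line k N x \<inter> line k N y) \<le> 1" if "x \<in> ?I" "y \<in> ?I" "x \<noteq> y" for x y
    using that card_lines_inter [OF _ _ _ _ _ cop] by (cases x; cases y) auto
  have "inj_on (line k N) ?I"
  proof (rule inj_onI, rule ccontr)
    fix x y assume "x \<in> ?I" "y \<in> ?I" "line k N x = line k N y" "x \<noteq> y"
    then have "k \<le> 1" using inter [of x y] card_line [OF \<open>0 < N\<close>, of k] by simp
    with assms show False by simp
  qed
  then have cardF: "card (line k N ` ?I) = N\<^sup>2" by (simp add: card_image card_cartesian_product power2_eq_square)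
  have kN: "k * N = k + fact k * k ^ 4" by (simp add: N_def algebra_simps power_Suc2 numeral_eq_Suc)
  have "real (k * N) \<le> exp ((real k)\<^sup>2)"
    using fact_power_le_exp_square [OF assms] by (simp add: kN)
  moreover have "(real k)\<^sup>2 * real (k * N) * real (fact k) < real (N\<^sup>2)"
  proof -
    \<comment> \<open>With \<open>k\<^sup>2\<close> as bound for the logarithm, the required product
      is exactly \<open>(N - 1) * N\<close>; this dictates the factor \<open>k ^ 3\<close> in
      \<open>N\<close>.\<close>
    have "(real k)\<^sup>2 * real (k * N) * real (fact k) = real (fact k * k ^ 3) * real N"
      by (simp add: power2_eq_square power3_eq_cube)
    also have "\<dots> < real N * real N"
      using \<open>0 < N\<close> by (intro mult_strict_right_mono) (simp_all add: N_def del: of_nat_mult)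
    finally show ?thesis by (simp add: power2_eq_square)
  qed
  ultimately have "(k * N) ^ (k * N) * (fact k - 1) ^ N\<^sup>2 < (fact k ^ N\<^sup>2 :: nat)"
    by (intro counting_bound) auto
  then have "\<exists>E. oriented_graph k {..<k * N} E \<and> linear_edges E \<and> property_O {..<k * N} E
      \<and> card E = card (line k N ` ?I)"
  proof (intro exists_property_O_orientation)
    show "S \<subseteq> {..<k * N} \<and> card S = k" if "S \<in> line k N ` ?I" for S
      using that line_subset [OF \<open>0 < N\<close>] card_line [OF \<open>0 < N\<close>] by blast
    show "card (S \<inter> T) \<le> 1" if "S \<in> line k N ` ?I" "T \<in> line k N ` ?I" "S \<noteq> T" for S T
      using that inter by blast
  qed (simp_all only: cardF card_lessThan finite_lessThan)
  then obtain E where "oriented_graph k {..<k * N} E" "linear_edges E" "property_O {..<k * N} E"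
      "card E = card (line k N ` ?I)" by blast
  then show ?thesis using cardF kN by (intro exI [of _ "{..<k * N}"] exI [of _ E]) (simp add: N_def)
qed

section \<open>The extremal numbers\<close>

lemma min_or_0_in:
  assumes "X \<noteq> {}"
  shows "min_or_0 X \<in> X"
  using assms by (simp add: min_or_0_def Inf_nat_def1)

lemma min_or_0_le:
  assumes "x \<in> X"
  shows "min_or_0 X \<le> x"
  using assms by (auto simp: min_or_0_def intro: cInf_lower)

lemma min_edges_lower:
  assumes "k \<ge> 2"
  shows "(fact k)\<^sup>2 / (2 * (exp 1)\<^sup>2 * real k ^ 4) \<le> real (min_edges k)"
proof -
  let ?X = "{card E | (V :: nat set) E. oriented_graph k V E \<and> linear_edges E \<and> property_O V E}"
  \<comment> \<open>The construction rules out the default value 0, so the minimum is attained by an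
    actual graph.\<close>
  have "?X \<noteq> {}" using exists_linear_property_O [OF assms] by blast
  from min_or_0_in [OF this] obtain V E where "oriented_graph k V E" "linear_edges E"
    "property_O (V :: nat set) E" "min_edges k = card E"
    unfolding min_edges_def by blast
  then show ?thesis using property_O_linear_card_edges assms by simp
qed

lemma min_vertices_lower:
  assumes "k \<ge> 2"
  shows "(real k - 1) * fact (k - 1) / (exp 1 * real k) \<le> real (min_vertices k)"
proof -
  let ?X = "{card V | (V :: nat set) E. oriented_graph k V E \<and> linear_edges E \<and> property_O V E}"
  have "?X \<noteq> {}" using exists_linear_property_O [OF assms] by blast
  from min_or_0_in [OF this] obtain V E where "oriented_graph k V E" "linear_edges E"
    "property_O (V :: nat set) E" "min_vertices k = card V"
    unfolding min_vertices_def by blast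
  then show ?thesis using property_O_linear_card_vertices assms by simp
qed

lemma min_edges_le:
  assumes "k \<ge> 2"
  shows "min_edges k \<le> (1 + fact k * k ^ 3)\<^sup>2"
proof -
  obtain V E where VE: "oriented_graph k (V :: nat set) E" "linear_edges E" "property_O V E"
    and card: "card E = (1 + fact k * k ^ 3)\<^sup>2"
    using exists_linear_property_O [OF assms] by blast
  have "min_edges k \<le> card E" unfolding min_edges_def using VE by (intro min_or_0_le) blast
  then show ?thesis by (simp only: card)
qed

lemma min_vertices_le:
  assumes "k \<ge> 2"
  shows "min_vertices k \<le> k + fact k * k ^ 4"
proof -
  obtain V E where VE: "oriented_graph k (V :: nat set) E" "linear_edges E" "property_O V E"
    and card: "card V = k + fact k * k ^ 4"
    using exists_linear_property_O [OF assms] by blast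
  have "min_vertices k \<le> card V" unfolding min_vertices_def using VE by (intro min_or_0_le) blast
  then show ?thesis by (simp only: card)
qed

section \<open>Comparison with the stated upper bounds\<close>

lemma ln_ge_three_fifths:
  assumes "k \<ge> 2"
  shows "3 / 5 \<le> ln (real k)"
proof -
  \<comment> \<open>From \<open>e \<le> 3\<close>, the cube of \<open>e\<close> is at most 27, which
    is below \<open>2 ^ 5 = 32\<close>; hence \<open>ln 2 \<ge> 3 / 5\<close>.\<close>
  have "exp (3 :: real) = exp 1 ^ 3" by (simp flip: exp_of_nat_mult)
  also have "\<dots> \<le> 3 ^ 3" using exp_le by (intro power_mono) auto
  also have "\<dots> \<le> (2 :: real) ^ 5" by simp
  finally have "ln (exp 3) \<le> ln ((2 :: real) ^ 5)" by (subst ln_le_cancel_iff) auto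
  also have "ln ((2 :: real) ^ 5) = 5 * ln 2" by (subst ln_realpow) simp_all
  finally have "3 \<le> 5 * ln (2 :: real)" by (simp only: ln_exp)
  moreover have "ln 2 \<le> ln (real k)" using assms by simp
  ultimately show ?thesis by linarith
qed

lemma min_edges_upper:
  assumes "k \<ge> 2"
  shows "real (min_edges k) \<le> 4 * real k ^ 6 * (ln (real k))\<^sup>2 * (fact k)\<^sup>2"
proof -
  define X :: real where "X = fact k * real k ^ 3"
  \<comment> \<open>Since \<open>2 * (3 / 5)\<close> is \<open>6 / 5\<close>, absorbing the summand
    1 below requires \<open>X \<ge> 5\<close>; the value at \<open>k = 2\<close> is already
    16.\<close>
  have "2 * 2 ^ 3 \<le> X"
    unfolding X_def using assms fact_mono [of 2 k, where 'a = real] by (intro mult_mono power_mono) auto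
  then have X: "16 \<le> X" by simp
  have "2 * (3 / 5) * X \<le> 2 * ln (real k) * X"
    using ln_ge_three_fifths [OF assms] X by (intro mult_right_mono mult_left_mono) auto
  then have le: "1 + X \<le> 2 * ln (real k) * X" using X by linarith
  have "real (min_edges k) \<le> real ((1 + fact k * k ^ 3)\<^sup>2)"
    using min_edges_le [OF assms] by (rule of_nat_mono)
  also have "\<dots> = (1 + X)\<^sup>2" by (simp add: X_def)
  also have "\<dots> \<le> (2 * ln (real k) * X)\<^sup>2" using le X by (intro power_mono) auto
  also have "\<dots> = 4 * real k ^ 6 * (ln (real k))\<^sup>2 * (fact k)\<^sup>2"
    by (simp add: X_def power_mult_distrib flip: power_mult)
  finally show ?thesis .
qed

lemma min_vertices_upper:
  assumes "k \<ge> 2"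
  shows "real (min_vertices k) \<le> 4 * real k ^ 4 * ln (real k) * fact k"
proof -
  define Y :: real where "Y = fact k * real k ^ 4"
  have "1 * real k ^ 1 \<le> Y"
    unfolding Y_def using assms fact_ge_1 [of k, where 'a = real]
    by (intro mult_mono power_increasing) auto
  then have Y: "real k \<le> Y" by simp
  have "real (min_vertices k) \<le> real (k + fact k * k ^ 4)"
    using min_vertices_le [OF assms] by (rule of_nat_mono)
  also have "\<dots> = real k + Y" by (simp add: Y_def)
  also have "\<dots> \<le> 4 * (3 / 5) * Y" using Y by linarith
  also have "\<dots> \<le> 4 * ln (real k) * Y"
    using ln_ge_three_fifths [OF assms] Y by (intro mult_right_mono mult_left_mono) auto
  also have "\<dots> = 4 * real k ^ 4 * ln (real k) * fact k" by (simp add: Y_def)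
  finally show ?thesis .
qed

theorem theorem1p5:
  shows
    "(\<forall>k::nat. k \<ge> 2 \<longrightarrow>
        (fact k)\<^sup>2 / (2 * (exp 1)\<^sup>2 * real k ^ 4) \<le> real (min_edges k)) \<and>
     (\<exists>\<epsilon> :: nat \<Rightarrow> real. \<epsilon> \<longlonglongrightarrow> 0 \<and>
        (\<forall>k::nat. k \<ge> 2 \<longrightarrow>
           real (min_edges k) \<le> (1 + \<epsilon> k) * (4 * real k ^ 6 * (ln (real k))\<^sup>2 * (fact k)\<^sup>2))) \<and>
     (\<forall>k::nat. k \<ge> 2 \<longrightarrow>
        (real k - 1) * fact (k - 1) / (exp 1 * real k) \<le> real (min_vertices k)) \<and>
     (\<exists>\<epsilon> :: nat \<Rightarrow> real. \<epsilon> \<longlonglongrightarrow> 0 \<and>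
        (\<forall>k::nat. k \<ge> 2 \<longrightarrow>
           real (min_vertices k) \<le> (1 + \<epsilon> k) * (4 * real k ^ 4 * ln (real k) * fact k)))"
  by (intro conjI allI impI exI [of _ "\<lambda>_. 0 :: real"] tendsto_const)
    (simp_all only: min_edges_lower min_vertices_lower min_edges_upper min_vertices_upper add_0_right mult_1_left)

end
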